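(* Let $\Gamma$ be a decorated Feynman diagram whose underlying graph is a tree. Then $S_n(\Gamma)$, as a function of the integer $n\ge1$, is a Laurent polynomial of $n$.
   Context: A decorated Feynman diagram is a connected graph $\Gamma=(V(\Gamma),E(\Gamma))$ each of whose edges $e$ is decorated by a finite set of positive integers, written $(m_{1,e},\dots,m_{k,e})$ ($k$ depends on $e$). For $v\in V(\Gamma)$, $E(v)$ is the set of edges incident to $v$. $B_m(x)$ are the Bernoulli polynomials, $\frac{te^{tx}}{e^t-1}=\sum_{m\ge0}B_m(x)\frac{t^m}{m!}$. For an integer $n\ge 1$, $$S_n(\Gamma)=\sum_{(a_e)}\ \prod_{e\in E(\Gamma)}B_{m_{1,e}}\!\Big(\frac{a_e}{n}\Big)\cdots B_{m_{k,e}}\!\Big(\frac{a_e}{n}\Big),$$ the sum being over all families of integers $(a_e)_{e\in E(\Gamma)}$ with $0\le a_e\le n-1$ such that $\sum_{e\in E(v)}a_e\equiv0\pmod n$ for every vertex $v$ of valence $\ge2$. *)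

theory Defs
  imports
    Complex_Main
    "HOL-Library.FuncSet"
    "HOL-Library.Multiset"
    "HOL-Library.Poly_Mapping"
    "HOL-Computational_Algebra.Formal_Power_Series"
    "HOL-Number_Theory.Cong"
begin

section \<open>Bernoulli polynomials\<close>

text \<open>Coefficients of \<open>t e\<^sup>t\<^sup>x / (e\<^sup>t - 1)\<close>, a formal power series in \<open>t\<close> for each \<open>x\<close>.\<close>

definition bernoulli_poly :: "nat \<Rightarrow> real \<Rightarrow> real" where
  "bernoulli_poly m x = fact m * fps_nth (fps_X * fps_exp x / (fps_exp 1 - 1)) m"

text \<open>The division of power series above is exact, although \<open>e\<^sup>t - 1\<close> is not a unit.\<close>

lemma bernoulli_poly_generating_function:
  "Abs_fps (\<lambda>m. bernoulli_poly m x / fact m) * (fps_exp 1 - 1) = fps_X * fps_exp x"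
proof -
  let ?g = "fps_exp 1 - 1 :: real fps"
  have "Abs_fps (\<lambda>m. bernoulli_poly m x / fact m) = fps_X * fps_exp x / ?g"
    by (simp add: fps_eq_iff bernoulli_poly_def)
  moreover have "?g dvd fps_X * fps_exp x"
  proof -
    have sd: "subdegree ?g = 1"
      by (rule subdegreeI) auto
    then have "?g \<noteq> 0" by auto
    moreover have "subdegree (fps_X * fps_exp x :: real fps) = 1"
      by (rule subdegreeI) auto
    then have "fps_X * fps_exp x \<noteq> (0 :: real fps)" by auto
    ultimately show ?thesis
      using sd \<open>subdegree (fps_X * fps_exp x :: real fps) = 1\<close> by (simp add: fps_dvd_iff)
  qed
  ultimately show ?thesis by simp
qed

section \<open>Decorated Feynman diagrams\<close>

text \<open>
  The underlying graphs are undirected; loops and parallel edges are allowed.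
  A loop at \<open>v\<close> has \<open>ends G e = {v}\<close>.
  The decoration of an edge is a multiset, so that numbers may be repeated among
  \<open>m\<^sub>1, \<dots>, m\<^sub>k\<close>; it may be empty.
\<close>

record ('v, 'e) diagram =
  verts :: "'v set"
  edges :: "'e set"
  ends :: "'e \<Rightarrow> 'v set"
  decoration :: "'e \<Rightarrow> nat multiset"

definition is_graph :: "('v, 'e) diagram \<Rightarrow> bool" where
  "is_graph G \<longleftrightarrow> finite (verts G) \<and> finite (edges G) \<and>
     (\<forall>e\<in>edges G. ends G e \<subseteq> verts G \<and> card (ends G e) \<in> {1, 2})"

text \<open>A walk is given by its vertices \<open>v\<^sub>0, \<dots>, v\<^sub>r\<close> and its edges \<open>e\<^sub>1, \<dots>, e\<^sub>r\<close>.\<close>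

definition is_walk :: "('v, 'e) diagram \<Rightarrow> 'v list \<Rightarrow> 'e list \<Rightarrow> bool" where
  "is_walk G vs es \<longleftrightarrow> length vs = Suc (length es) \<and>
     set vs \<subseteq> verts G \<and> set es \<subseteq> edges G \<and>
     (\<forall>i<length es. ends G (es ! i) = {vs ! i, vs ! Suc i})"

definition connected_graph :: "('v, 'e) diagram \<Rightarrow> bool" where
  "connected_graph G \<longleftrightarrow> verts G \<noteq> {} \<and>
     (\<forall>u\<in>verts G. \<forall>v\<in>verts G. \<exists>vs es. is_walk G vs es \<and> hd vs = u \<and> last vs = v)"

text \<open>
  Requiring distinct edges excludes going back and forth along one edge.
  Loops and pairs of parallel edges are cycles.
\<close>

definition is_cycle :: "('v, 'e) diagram \<Rightarrow> 'v list \<Rightarrow> 'e list \<Rightarrow> bool" where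
  "is_cycle G vs es \<longleftrightarrow> is_walk G vs es \<and> es \<noteq> [] \<and> hd vs = last vs \<and>
     distinct (tl vs) \<and> distinct es"

definition is_tree :: "('v, 'e) diagram \<Rightarrow> bool" where
  "is_tree G \<longleftrightarrow> is_graph G \<and> connected_graph G \<and> \<not> (\<exists>vs es. is_cycle G vs es)"

definition decorated_Feynman_diagram :: "('v, 'e) diagram \<Rightarrow> bool" where
  "decorated_Feynman_diagram G \<longleftrightarrow> is_graph G \<and> connected_graph G \<and>
     (\<forall>e\<in>edges G. \<forall>m\<in>#decoration G e. m \<ge> 1)"

definition incident_edges :: "('v, 'e) diagram \<Rightarrow> 'v \<Rightarrow> 'e set" where
  "incident_edges G v = {e \<in> edges G. v \<in> ends G e}"

text \<open>Loops count twice.\<close>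

definition valence :: "('v, 'e) diagram \<Rightarrow> 'v \<Rightarrow> nat" where
  "valence G v = card (incident_edges G v) + card {e \<in> edges G. ends G e = {v}}"

section \<open>The sums and Laurent polynomials\<close>

definition admissible_families :: "nat \<Rightarrow> ('v, 'e) diagram \<Rightarrow> ('e \<Rightarrow> int) set" where
  "admissible_families n G =
     {a \<in> edges G \<rightarrow>\<^sub>E {0..int n - 1}.
        \<forall>v\<in>verts G. valence G v \<ge> 2 \<longrightarrow> [(\<Sum>e\<in>incident_edges G v. a e) = 0] (mod int n)}"

definition S :: "nat \<Rightarrow> ('v, 'e) diagram \<Rightarrow> real" where
  "S n G = (\<Sum>a\<in>admissible_families n G. \<Prod>e\<in>edges G.
              \<Prod>m\<in>#decoration G e. bernoulli_poly m (of_int (a e) / of_nat n))"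

text \<open>
  Laurent polynomials are finitely supported families of coefficients indexed by the integers.
\<close>

definition eval_laurent :: "(int \<Rightarrow>\<^sub>0 real) \<Rightarrow> real \<Rightarrow> real" where
  "eval_laurent P x = (\<Sum>k\<in>Poly_Mapping.keys P. Poly_Mapping.lookup P k * x powi k)"

end

theory Submission
  imports Defs
begin

text \<open>
  A sum over a tree can be evaluated by removing one leaf after another, as in the method of
  transfer matrices. To make this work, every edge \<open>e\<close> gets an arbitrary weight \<open>f e\<close>, evaluated at
  the variable \<open>a\<^sub>e\<close>, and every vertex \<open>v\<close> an arbitrary weight \<open>h v\<close>, evaluated at the sum of the
  variables around \<open>v\<close>. The congruence at a vertex of valence at least two is the weight
  \<open>delta\<close>, the indicator of the residue zero, and the absence of a condition is the weight \<open>1\<close>.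
  If \<open>v\<close> is a leaf, joined by \<open>e\<close> to \<open>w\<close>, then \<open>a\<^sub>e\<close> occurs only in the weights of \<open>e\<close>, \<open>v\<close> and
  \<open>w\<close>. Summing over \<open>a\<^sub>e\<close> gives the weighted sum of the graph without \<open>e\<close>, where the weight of \<open>w\<close>
  has become its cyclic correlation with \<open>f e \<cdot> h v\<close> (\<open>weighted_sum_leaf\<close>).

  What remains is a class of functions on the residues modulo \<open>n\<close>, given uniformly in \<open>n\<close>, that
  contains the weights at the start and is closed under products and correlation. Polynomials in the
  representative \<open>a \<in> {0..n - 1}\<close> with Laurent polynomials in \<open>n\<close> as coefficients nearly suffice.
  The exception is the correlation with \<open>delta\<close>, which reflects a function: the representative of
  \<open>-a\<close> is \<open>n - a\<close>, except that it is \<open>0\<close> when \<open>a = 0\<close>. The defect is a multiple of \<open>delta\<close>, so the class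
  spanned by these polynomials and \<open>delta\<close> is closed under both operations
  (\<open>residue_poly_mult\<close>, \<open>residue_poly_correlation\<close>). When no edges are left, the sum is a product of
  values at the residue zero, and these are Laurent polynomials in \<open>n\<close>. A leaf exists as long as
  the graph is acyclic and has an edge (\<open>acyclic_has_leaf\<close>); connectedness is not preserved by the
  removal of edges, so the induction runs over all acyclic graphs.
\<close>

section \<open>Laurent polynomial functions\<close>

text \<open>
  Sequences indexed by the natural numbers, with no condition at \<open>n = 0\<close>, where negative powers have
  the value \<open>0\<close> only by convention.
\<close>

definition laurent_fun :: "(nat \<Rightarrow> real) \<Rightarrow> bool" where
  "laurent_fun c \<longleftrightarrow> (\<exists>P. \<forall>n\<ge>1. c n = eval_laurent P (real n))"

lemma laurent_fun_cong:
  assumes "laurent_fun c" and "\<And>n. n \<ge> 1 \<Longrightarrow> c n = d n"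
  shows "laurent_fun d"
  using assms by (auto simp: laurent_fun_def)

lemma eval_laurent_superset:
  assumes "finite A" and "Poly_Mapping.keys P \<subseteq> A"
  shows "eval_laurent P x = (\<Sum>k\<in>A. Poly_Mapping.lookup P k * x powi k)"
  unfolding eval_laurent_def
  using assms by (intro sum.mono_neutral_left) (auto simp: in_keys_iff)

lemma laurent_fun_monomial: "laurent_fun (\<lambda>n. c * real n powi k)"
proof -
  have "eval_laurent (Poly_Mapping.single k c) x = c * x powi k" for x
    by (subst eval_laurent_superset[of "{k}"]) auto
  then show ?thesis
    unfolding laurent_fun_def by (metis)
qed

lemma laurent_fun_const: "laurent_fun (\<lambda>n. c)"
  using laurent_fun_monomial[of c 0] by simp

lemma laurent_fun_add:
  assumes "laurent_fun c" and "laurent_fun d"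
  shows "laurent_fun (\<lambda>n. c n + d n)"
proof -
  obtain P Q where PQ: "\<And>n. n \<ge> 1 \<Longrightarrow> c n = eval_laurent P (real n)"
      "\<And>n. n \<ge> 1 \<Longrightarrow> d n = eval_laurent Q (real n)"
    using assms by (auto simp: laurent_fun_def)
  have "eval_laurent (P + Q) x = eval_laurent P x + eval_laurent Q x" for x
  proof -
    let ?A = "Poly_Mapping.keys P \<union> Poly_Mapping.keys Q"
    have "Poly_Mapping.keys (P + Q) \<subseteq> ?A"
      by (rule Poly_Mapping.keys_add)
    then show ?thesis
      by (simp add: eval_laurent_superset[of ?A] lookup_add distrib_right sum.distrib)
  qed
  with PQ show ?thesis
    unfolding laurent_fun_def by (intro exI[of _ "P + Q"]) simp
qed

lemma laurent_fun_sum: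
  assumes "\<And>i. i \<in> A \<Longrightarrow> laurent_fun (c i)"
  shows "laurent_fun (\<lambda>n. \<Sum>i\<in>A. c i n)"
  using assms
  by (induction A rule: infinite_finite_induct) (auto intro: laurent_fun_const laurent_fun_add)

lemma laurent_fun_mult:
  assumes "laurent_fun c" and "laurent_fun d"
  shows "laurent_fun (\<lambda>n. c n * d n)"
proof -
  obtain P Q where PQ: "\<And>n. n \<ge> 1 \<Longrightarrow> c n = eval_laurent P (real n)"
      "\<And>n. n \<ge> 1 \<Longrightarrow> d n = eval_laurent Q (real n)"
    using assms by (auto simp: laurent_fun_def)
  let ?p = "Poly_Mapping.lookup P" and ?q = "Poly_Mapping.lookup Q"
  have "laurent_fun (\<lambda>n. \<Sum>k\<in>Poly_Mapping.keys P. \<Sum>l\<in>Poly_Mapping.keys Q.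
          (?p k * ?q l) * real n powi (k + l))"
    by (intro laurent_fun_sum laurent_fun_monomial)
  then show ?thesis
    by (rule laurent_fun_cong)
      (simp add: PQ eval_laurent_def sum_product power_int_add algebra_simps)
qed

lemma laurent_fun_prod:
  assumes "\<And>i. i \<in> A \<Longrightarrow> laurent_fun (c i)"
  shows "laurent_fun (\<lambda>n. \<Prod>i\<in>A. c i n)"
  using assms
  by (induction A rule: infinite_finite_induct) (auto intro: laurent_fun_const laurent_fun_mult)

section \<open>Polynomials in the residue, corrected at the residue zero\<close>

definition delta :: "nat \<Rightarrow> int \<Rightarrow> real" where
  "delta n a = (if int n dvd a then 1 else 0)"

text \<open>
  The span of the powers of the residue and of \<open>delta\<close> over the Laurent polynomials in \<open>n\<close>. The
  functions take integer arguments and have period \<open>n\<close>. The inductive form lets linear and bilinear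
  operations be treated generator by generator; the last rule is needed because their values at
  \<open>n = 0\<close> are uncontrolled.
\<close>

inductive residue_poly :: "(nat \<Rightarrow> int \<Rightarrow> real) \<Rightarrow> bool" where
  monomial: "laurent_fun c \<Longrightarrow> residue_poly (\<lambda>n a. c n * of_int (a mod int n) ^ i)"
| delta: "laurent_fun c \<Longrightarrow> residue_poly (\<lambda>n a. c n * delta n a)"
| add: "residue_poly f \<Longrightarrow> residue_poly g \<Longrightarrow> residue_poly (\<lambda>n a. f n a + g n a)"
| cong: "residue_poly f \<Longrightarrow> (\<And>n a. n \<ge> 1 \<Longrightarrow> f n a = g n a) \<Longrightarrow> residue_poly g"

lemma residue_poly_laurent: "laurent_fun c \<Longrightarrow> residue_poly (\<lambda>n a. c n)"
  using residue_poly.monomial[of c 0] by simp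

lemma residue_poly_const: "residue_poly (\<lambda>n a. c)"
  by (intro residue_poly_laurent laurent_fun_const)

lemma residue_poly_modulus: "residue_poly (\<lambda>n a. real n)"
  using residue_poly_laurent[OF laurent_fun_monomial[of 1 1]] by simp

lemma residue_poly_residue: "residue_poly (\<lambda>n a. of_int (a mod int n))"
  using residue_poly.monomial[OF laurent_fun_const[of 1], of 1] by simp

lemma residue_poly_delta: "residue_poly delta"
  using residue_poly.delta[OF laurent_fun_const[of 1]] by simp

lemma residue_poly_mult_laurent:
  assumes "residue_poly f" and "laurent_fun c"
  shows "residue_poly (\<lambda>n a. c n * f n a)"
  using assms
proof induction
  case (monomial d i)
  then show ?case
    using residue_poly.monomial[OF laurent_fun_mult, of c d i] by (simp add: mult.assoc)
next
  case (delta d)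
  then show ?case
    using residue_poly.delta[OF laurent_fun_mult, of c d] by (simp add: mult.assoc)
next
  case (add f g)
  then show ?case by (simp add: distrib_left residue_poly.add)
next
  case (cong f g)
  then show ?case by (auto intro: residue_poly.cong)
qed

lemma residue_poly_value_zero:
  assumes "residue_poly f"
  shows "laurent_fun (\<lambda>n. f n 0)"
  using assms
proof induction
  case (monomial c i)
  show ?case
    using laurent_fun_mult[OF monomial laurent_fun_const[of "0 ^ i"]] by simp
next
  case (cong f g)
  then show ?case by (auto intro: laurent_fun_cong)
qed (simp_all add: delta_def laurent_fun_add)

text \<open>
  By periodicity, multiplication by \<open>delta\<close> sees only the value at zero, so the product is a Laurent
  polynomial times \<open>delta\<close>.
\<close>

lemma residue_poly_mult_delta:
  assumes "residue_poly f"
  shows "residue_poly (\<lambda>n a. delta n a * f n a)"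
proof -
  have periodic: "f n a = f n 0" if "n \<ge> 1" and "int n dvd a" for n a
    using assms that by induction (auto simp: delta_def)
  show ?thesis
  proof (rule residue_poly.cong[OF residue_poly.delta[OF residue_poly_value_zero[OF assms]]])
    fix n :: nat and a :: int
    assume "n \<ge> 1"
    then show "f n 0 * delta n a = delta n a * f n a"
      using periodic[of n a] by (simp add: delta_def)
  qed
qed

lemma residue_poly_mult_residue:
  assumes "residue_poly f"
  shows "residue_poly (\<lambda>n a. of_int (a mod int n) ^ i * f n a)"
  using assms
proof induction
  case (monomial c j)
  then show ?case
    using residue_poly.monomial[of c "i + j"] by (simp add: power_add algebra_simps)
next
  case (delta c)
  have "residue_poly (\<lambda>n a. c n * (delta n a * of_int (a mod int n) ^ i))"
    using residue_poly.monomial[OF laurent_fun_const[of 1], of i] delta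
    by (intro residue_poly_mult_laurent residue_poly_mult_delta) auto
  then show ?case by (simp add: algebra_simps)
next
  case (add f g)
  then show ?case by (simp add: distrib_left residue_poly.add)
next
  case (cong f g)
  then show ?case by (auto intro: residue_poly.cong)
qed

lemma residue_poly_mult:
  assumes "residue_poly f" and "residue_poly g"
  shows "residue_poly (\<lambda>n a. f n a * g n a)"
  using assms
proof induction
  case (monomial c i)
  then show ?case
    using residue_poly_mult_laurent[OF residue_poly_mult_residue, of g c i]
    by (simp add: mult.assoc)
next
  case (delta c)
  then show ?case
    using residue_poly_mult_laurent[OF residue_poly_mult_delta, of g c]
    by (simp add: mult.assoc)
next
  case (add f1 f2)
  then show ?case by (simp add: distrib_right residue_poly.add)
next
  case (cong f1 f2)
  from cong.IH[OF cong.prems] show ?case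
    by (rule residue_poly.cong) (simp add: cong.hyps)
qed

lemma residue_poly_diff:
  assumes "residue_poly f" and "residue_poly g"
  shows "residue_poly (\<lambda>n a. f n a - g n a)"
  using residue_poly.add[OF assms(1) residue_poly_mult[OF residue_poly_const[of "-1"] assms(2)]]
  by simp

lemma residue_poly_power:
  assumes "residue_poly f"
  shows "residue_poly (\<lambda>n a. f n a ^ i)"
  by (induction i) (auto intro: assms residue_poly_const residue_poly_mult)

lemma residue_poly_sum:
  assumes "\<And>i. i \<in> A \<Longrightarrow> residue_poly (f i)"
  shows "residue_poly (\<lambda>n a. \<Sum>i\<in>A. f i n a)"
  using assms
  by (induction A rule: infinite_finite_induct) (auto intro: residue_poly_const residue_poly.add)

section \<open>Summation over one residue\<close>

text \<open>
  Sums of polynomials over an initial segment whose length is itself in the class stay in the class.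
  This is Faulhaber's formula in the guise of a recurrence: telescoping \<open>(b + 1)\<^bsup>k+1\<^esup> - b\<^bsup>k+1\<^esup>\<close> expresses
  the sum of \<open>k\<close>-th powers by sums of lower powers.
\<close>

lemma power_sum_recurrence:
  "real (Suc k) * (\<Sum>b<N. real b ^ k) =
     real N ^ Suc k - (\<Sum>l<k. real (Suc k choose l) * (\<Sum>b<N. real b ^ l))"
proof -
  have "real N ^ Suc k = (\<Sum>b<N. real (Suc b) ^ Suc k - real b ^ Suc k)"
    by (subst sum_lessThan_telescope) simp
  also have "\<dots> = (\<Sum>b<N. \<Sum>l\<le>k. real (Suc k choose l) * real b ^ l)"
  proof (intro sum.cong refl)
    fix b
    have "real (Suc b) ^ Suc k = (\<Sum>l\<le>Suc k. real (Suc k choose l) * real b ^ l)"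
      using binomial_ring[of "real b" 1 "Suc k"] by (simp add: add.commute)
    then show "real (Suc b) ^ Suc k - real b ^ Suc k = (\<Sum>l\<le>k. real (Suc k choose l) * real b ^ l)"
      by simp
  qed
  also have "\<dots> = (\<Sum>l\<le>k. real (Suc k choose l) * (\<Sum>b<N. real b ^ l))"
    by (subst sum.swap) (simp add: sum_distrib_left)
  also have "\<dots> = (\<Sum>l<k. real (Suc k choose l) * (\<Sum>b<N. real b ^ l))
                   + real (Suc k) * (\<Sum>b<N. real b ^ k)"
    by (simp add: lessThan_Suc_atMost[symmetric] del: of_nat_Suc)
  finally show ?thesis by linarith
qed

lemma residue_poly_power_sum:
  assumes "residue_poly (\<lambda>n a. real (N n a))"
  shows "residue_poly (\<lambda>n a. \<Sum>b<N n a. real b ^ k)"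
proof (induction k rule: less_induct)
  case (less k)
  have "residue_poly (\<lambda>n a. inverse (real (Suc k)) *
          (real (N n a) ^ Suc k - (\<Sum>l<k. real (Suc k choose l) * (\<Sum>b<N n a. real b ^ l))))"
    by (intro residue_poly_mult residue_poly_diff residue_poly_power residue_poly_sum
        residue_poly_const assms less) auto
  then show ?case
    unfolding power_sum_recurrence[symmetric] by (simp add: mult.assoc[symmetric] del: of_nat_Suc)
qed

lemma residue_poly_shifted_sum:
  assumes "residue_poly (\<lambda>n a. real (N n a))" and "residue_poly u"
  shows "residue_poly (\<lambda>n a. \<Sum>b<N n a. real b ^ i * (real b + u n a) ^ j)"
proof -
  have "residue_poly (\<lambda>n a. \<Sum>l\<le>j. real (j choose l) * u n a ^ (j - l) * (\<Sum>b<N n a. real b ^ (i + l)))"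
    by (intro residue_poly_sum residue_poly_mult residue_poly_power residue_poly_const
        residue_poly_power_sum assms)
  moreover have "(\<Sum>b<N n a. real b ^ i * (real b + u n a) ^ j) =
      (\<Sum>l\<le>j. real (j choose l) * u n a ^ (j - l) * (\<Sum>b<N n a. real b ^ (i + l)))" for n a
  proof -
    have "(\<Sum>b<N n a. real b ^ i * (real b + u n a) ^ j) =
        (\<Sum>b<N n a. \<Sum>l\<le>j. real (j choose l) * u n a ^ (j - l) * real b ^ (i + l))"
      by (simp add: binomial_ring sum_distrib_left power_add algebra_simps)
    then show ?thesis
      by (subst (asm) sum.swap) (simp add: sum_distrib_left)
  qed
  ultimately show ?thesis by simp
qed

text \<open>
  A leaf edge with value \<open>b\<close> adds \<open>b\<close> to the sum \<open>s\<close> of the other variables at its inner vertex; hence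
  correlation, with argument \<open>s + b\<close>, rather than convolution.
\<close>

definition correlation :: "(nat \<Rightarrow> int \<Rightarrow> real) \<Rightarrow> (nat \<Rightarrow> int \<Rightarrow> real) \<Rightarrow> nat \<Rightarrow> int \<Rightarrow> real" where
  "correlation f g n s = (\<Sum>b<n. f n (int b) * g n (s + int b))"

text \<open>
  Let \<open>t\<close> be the residue of \<open>s\<close>. The residue of \<open>s + b\<close> is \<open>t + b\<close> for \<open>b < n - t\<close> and
  \<open>t + b - n\<close> from there on. Using the second form throughout and correcting it for \<open>b < n - t\<close>
  leaves sums over initial segments only.
\<close>

lemma residue_poly_correlation_monomials:
  "residue_poly (correlation (\<lambda>n a. of_int (a mod int n) ^ i) (\<lambda>n a. of_int (a mod int n) ^ j))"
proof -
  let ?r = "\<lambda>n s. of_int (s mod int n) :: real"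
  let ?N = "\<lambda>n s. nat (int n - s mod int n)"
  have N_eq: "real n - ?r n s = real (?N n s)" if "n \<ge> 1" for n s
  proof -
    have "s mod int n < int n" using that by simp
    then show ?thesis by simp
  qed
  have N: "residue_poly (\<lambda>n s. real (?N n s))"
    by (rule residue_poly.cong[OF residue_poly_diff[OF residue_poly_modulus residue_poly_residue]])
      (rule N_eq)
  have u: "residue_poly (\<lambda>n s. ?r n s - real n)"
    by (intro residue_poly_diff residue_poly_residue residue_poly_modulus)
  have "residue_poly (\<lambda>n s. (\<Sum>b<n. real b ^ i * (real b + (?r n s - real n)) ^ j) +
      ((\<Sum>b<?N n s. real b ^ i * (real b + ?r n s) ^ j) -
       (\<Sum>b<?N n s. real b ^ i * (real b + (?r n s - real n)) ^ j)))"
    by (intro residue_poly.add residue_poly_diff residue_poly_shifted_sum N u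
        residue_poly_residue residue_poly_modulus)
  then show ?thesis
  proof (rule residue_poly.cong)
    fix n :: nat and s :: int
    assume n: "n \<ge> 1"
    let ?t = "s mod int n"
    have t: "0 \<le> ?t" "?t < int n" using n by auto
    let ?f = "\<lambda>b. real b ^ i * (real b + (?r n s - real n)) ^ j"
    let ?g = "\<lambda>b. real b ^ i * (real b + ?r n s) ^ j"
    have wrap: "of_int (int b mod int n) ^ i * of_int ((s + int b) mod int n) ^ j =
        (if b < ?N n s then ?g b else ?f b)" if "b < n" for b
    proof -
      have "(s + int b) mod int n = (?t + int b) mod int n"
        by (simp add: mod_add_left_eq)
      also have "\<dots> = (if b < ?N n s then ?t + int b else ?t + int b - int n)"
      proof (cases "b < ?N n s")
        case False
        then have "(?t + int b) mod int n = (?t + int b - int n) mod int n"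
          by simp
        also have "\<dots> = ?t + int b - int n"
          by (rule mod_pos_pos_trivial) (use False t that in linarith)+
        finally show ?thesis using False by simp
      qed (use t in auto)
      finally show ?thesis using that by (simp add: algebra_simps)
    qed
    have "correlation (\<lambda>n a. of_int (a mod int n) ^ i) (\<lambda>n a. of_int (a mod int n) ^ j) n s
        = (\<Sum>b<n. if b < ?N n s then ?g b else ?f b)"
      unfolding correlation_def by (intro sum.cong refl wrap) auto
    also have "\<dots> = (\<Sum>b<n. ?f b + (if b < ?N n s then ?g b - ?f b else 0))"
      by (intro sum.cong) auto
    also have "\<dots> = (\<Sum>b<n. ?f b) + (\<Sum>b\<in>{b\<in>{..<n}. b < ?N n s}. ?g b - ?f b)"
      by (simp add: sum.distrib flip: sum.inter_filter)
    also have "{b\<in>{..<n}. b < ?N n s} = {..<?N n s}"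
      using t by auto
    finally show "(\<Sum>b<n. ?f b) + ((\<Sum>b<?N n s. ?g b) - (\<Sum>b<?N n s. ?f b)) =
        correlation (\<lambda>n a. of_int (a mod int n) ^ i) (\<lambda>n a. of_int (a mod int n) ^ j) n s"
      by (simp add: sum_subtractf)
  qed
qed

lemma correlation_delta_left:
  assumes "n \<ge> 1"
  shows "correlation delta g n s = g n s"
proof -
  have "correlation delta g n s = (\<Sum>b<n. if b = 0 then g n s else 0)"
    unfolding correlation_def
    by (intro sum.cong) (auto simp: delta_def dest: nat_dvd_not_less)
  then show ?thesis using assms by simp
qed

text \<open>
  Only the \<open>b\<close> congruent to \<open>-s\<close> contributes. Its representative is \<open>n\<close> minus the residue of \<open>s\<close>
  unless \<open>n\<close> divides \<open>s\<close>; in that case the polynomial gives \<open>n\<^sup>i\<close> in place of \<open>0\<^sup>i\<close>.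
\<close>

lemma correlation_residue_delta:
  assumes "n \<ge> 1"
  shows "correlation (\<lambda>n a. of_int (a mod int n) ^ i) delta n s =
    (real n - of_int (s mod int n)) ^ i + (0 ^ i - real n ^ i) * delta n s"
proof -
  let ?c = "nat ((- s) mod int n)"
  have c: "int ?c = (- s) mod int n" "?c < n"
    using assms by (simp_all add: nat_less_iff)
  have dvd: "int n dvd s + int b \<longleftrightarrow> b = ?c" if "b < n" for b
  proof -
    have "int n dvd s + int b \<longleftrightarrow> (- s) mod int n = int b mod int n"
      by (metis dvd_minus_iff minus_add_distrib mod_eq_dvd_iff uminus_add_conv_diff add_uminus_conv_diff)
    also have "\<dots> \<longleftrightarrow> b = ?c"
      using that c by auto
    finally show ?thesis .
  qed
  have "correlation (\<lambda>n a. of_int (a mod int n) ^ i) delta n s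
      = (\<Sum>b<n. if b = ?c then real b ^ i else 0)"
    unfolding correlation_def
    by (intro sum.cong refl) (auto simp: delta_def dvd)
  also have "\<dots> = real ?c ^ i"
    using c by simp
  also have "real ?c = (if int n dvd s then 0 else real n - of_int (s mod int n))"
  proof -
    have "real ?c = of_int ((- s) mod int n)"
      using c(1) by (metis of_int_of_nat_eq)
    then show ?thesis by (simp add: zmod_zminus1_eq_if dvd_eq_mod_eq_0)
  qed
  finally show ?thesis
    by (auto simp: delta_def[of n s])
qed

lemma residue_poly_correlation:
  assumes f: "residue_poly f" and g: "residue_poly g"
  shows "residue_poly (correlation f g)"
  using f
proof induction
  case (monomial c i)
  let ?m = "\<lambda>n a. of_int (a mod int n) ^ i :: real"
  have "residue_poly (correlation ?m g)"
    using g
  proof induction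
    case (monomial d j)
    from residue_poly_mult_laurent[OF residue_poly_correlation_monomials monomial]
    show ?case
      by (rule residue_poly.cong) (simp add: correlation_def sum_distrib_left algebra_simps)
  next
    case (delta d)
    have "residue_poly (\<lambda>n a. (real n - of_int (a mod int n)) ^ i + (0 ^ i - real n ^ i) * delta n a)"
      by (intro residue_poly.add residue_poly_mult residue_poly_diff residue_poly_power
          residue_poly_const residue_poly_modulus residue_poly_residue residue_poly_delta)
    then have "residue_poly (correlation ?m delta)"
      by (rule residue_poly.cong) (simp add: correlation_residue_delta)
    from residue_poly_mult_laurent[OF this delta]
    show ?case
      by (rule residue_poly.cong) (simp add: correlation_def sum_distrib_left algebra_simps)
  next
    case (add g1 g2)
    from residue_poly.add[OF add.IH] show ?case
      by (rule residue_poly.cong) (simp add: correlation_def sum.distrib algebra_simps)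
  next
    case (cong g1 g2)
    from cong.IH show ?case
      by (rule residue_poly.cong) (simp add: correlation_def cong.hyps)
  qed
  from residue_poly_mult_laurent[OF this monomial] show ?case
    by (rule residue_poly.cong) (simp add: correlation_def sum_distrib_left algebra_simps)
next
  case (delta c)
  from residue_poly_mult_laurent[OF g delta] show ?case
  proof (rule residue_poly.cong)
    fix n :: nat and s :: int
    assume n: "n \<ge> 1"
    have "correlation (\<lambda>n a. c n * delta n a) g n s = c n * correlation delta g n s"
      by (simp add: correlation_def sum_distrib_left mult.assoc)
    then show "c n * g n s = correlation (\<lambda>n a. c n * delta n a) g n s"
      using n by (simp add: correlation_delta_left)
  qed
next
  case (add f1 f2)
  from residue_poly.add[OF add.IH] show ?case
    by (rule residue_poly.cong) (simp add: correlation_def sum.distrib algebra_simps)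
next
  case (cong f1 f2)
  from cong.IH show ?case
    by (rule residue_poly.cong) (simp add: correlation_def cong.hyps)
qed

section \<open>Bernoulli polynomials\<close>

text \<open>
  The generating function at \<open>x\<close> is the one at \<open>0\<close> times \<open>e\<^sup>t\<^sup>x\<close>. What matters is that the value is a
  polynomial in \<open>x\<close>.
\<close>

lemma bernoulli_poly_expansion:
  "bernoulli_poly m x =
     (\<Sum>i=0..m. fact m * (bernoulli_poly i 0 / (fact i * fact (m - i))) * x ^ (m - i))"
proof -
  let ?g = "fps_exp 1 - 1 :: real fps"
  let ?A = "\<lambda>x. Abs_fps (\<lambda>m. bernoulli_poly m x / fact m)"
  have "fps_nth ?g 1 \<noteq> 0" by simp
  then have "?g \<noteq> 0" by (metis fps_zero_nth)
  moreover have "?A x * ?g = (?A 0 * fps_exp x) * ?g"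
    using bernoulli_poly_generating_function[of x] bernoulli_poly_generating_function[of 0]
    by (simp add: mult.assoc mult.left_commute mult.commute)
  ultimately have "?A x = ?A 0 * fps_exp x" by simp
  then have "fps_nth (?A x) m = fps_nth (?A 0 * fps_exp x) m" by simp
  then have "bernoulli_poly m x / fact m =
      (\<Sum>i=0..m. bernoulli_poly i 0 / fact i * (x ^ (m - i) / fact (m - i)))"
    by (simp add: fps_mult_nth)
  then have "bernoulli_poly m x =
      fact m * (\<Sum>i=0..m. bernoulli_poly i 0 / fact i * (x ^ (m - i) / fact (m - i)))"
    by (simp add: field_simps)
  then show ?thesis
    unfolding sum_distrib_left by (elim trans) (intro sum.cong, auto)
qed

lemma residue_poly_bernoulli:
  "residue_poly (\<lambda>n a. bernoulli_poly m (of_int (a mod int n) / real n))"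
proof -
  have "residue_poly (\<lambda>n a. of_int (a mod int n) / real n)"
    using residue_poly_mult_laurent[OF residue_poly_residue laurent_fun_monomial[of 1 "-1"]]
    by (simp add: power_int_minus field_simps)
  then show ?thesis
    by (subst bernoulli_poly_expansion)
      (intro residue_poly_sum residue_poly_mult residue_poly_const residue_poly_power)
qed

lemma residue_poly_decoration:
  "residue_poly (\<lambda>n a. \<Prod>m\<in>#M. bernoulli_poly m (of_int (a mod int n) / real n))"
  by (induction M) (auto intro: residue_poly_const residue_poly_mult residue_poly_bernoulli)

section \<open>Leaves of acyclic graphs\<close>

text \<open>
  Both end points stay in the graph, so that the removal of a leaf edge only changes the weights of two
  vertices.
\<close>

definition delete_edge :: "('v, 'e) diagram \<Rightarrow> 'e \<Rightarrow> ('v, 'e) diagram" where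
  "delete_edge G e = G\<lparr>edges := edges G - {e}\<rparr>"

lemma delete_edge_simps [simp]:
  "verts (delete_edge G e) = verts G"
  "edges (delete_edge G e) = edges G - {e}"
  "ends (delete_edge G e) = ends G"
  "incident_edges (delete_edge G e) v = incident_edges G v - {e}"
  by (auto simp: delete_edge_def incident_edges_def)

lemma is_graph_delete_edge: "is_graph G \<Longrightarrow> is_graph (delete_edge G e)"
  by (auto simp: is_graph_def)

lemma is_cycle_delete_edge: "is_cycle (delete_edge G e) vs es \<Longrightarrow> is_cycle G vs es"
  by (auto simp: is_cycle_def is_walk_def)

lemma is_walk_Cons:
  assumes "is_walk G vs es" and "vs \<noteq> []" and "e \<in> edges G" and "ends G e = {u, hd vs}"
    and "u \<in> verts G"
  shows "is_walk G (u # vs) (e # es)"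
  using assms unfolding is_walk_def
  by (auto simp: nth_Cons hd_conv_nth split: nat.splits)

lemma acyclic_no_loop:
  assumes "is_graph G" and "\<nexists>vs es. is_cycle G vs es" and "e \<in> edges G"
  shows "card (ends G e) = 2"
proof (rule ccontr)
  assume "card (ends G e) \<noteq> 2"
  then have "card (ends G e) = 1"
    using assms by (auto simp: is_graph_def)
  then obtain v where v: "ends G e = {v}" by (auto simp: card_1_singleton_iff)
  then have "v \<in> verts G" using assms by (auto simp: is_graph_def)
  with v assms(3) have "is_cycle G [v, v] [e]"
    by (auto simp: is_cycle_def is_walk_def)
  with assms(2) show False by blast
qed

text \<open>
  The first edge of a path is its only edge that contains its first vertex. With both end points on the
  path given, this shows below that an edge closing a path to a cycle is new.
\<close>

lemma path_edge_index:
  assumes "is_walk G vs es" and "distinct vs" and "i < length es" and "j < length vs"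
    and "ends G (es ! i) = {vs ! 0, vs ! j}"
  shows "i = 0"
proof -
  have len: "length vs = Suc (length es)" and "ends G (es ! i) = {vs ! i, vs ! Suc i}"
    using assms by (auto simp: is_walk_def)
  with assms(5) have "vs ! 0 = vs ! i \<or> vs ! 0 = vs ! Suc i"
    by auto
  moreover have "vs ! 0 = vs ! i \<longleftrightarrow> 0 = i" "vs ! 0 = vs ! Suc i \<longleftrightarrow> 0 = Suc i"
    using assms(2,3) len by (intro nth_eq_iff_index_eq; simp)+
  ultimately show ?thesis by simp
qed

lemma distinct_path_edges:
  assumes "is_walk G vs es" and "distinct vs"
  shows "distinct es"
  unfolding distinct_conv_nth
proof (intro allI impI notI)
  fix i j assume ij: "i < length es" "j < length es" "i \<noteq> j" "es ! i = es ! j"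
  have len: "length vs = Suc (length es)"
    and ends: "\<And>k. k < length es \<Longrightarrow> ends G (es ! k) = {vs ! k, vs ! Suc k}"
    using assms by (auto simp: is_walk_def)
  have eq: "{vs ! i, vs ! Suc i} = {vs ! j, vs ! Suc j}"
    using ends[OF ij(1)] ends[OF ij(2)] ij(4) by simp
  have inj: "vs ! k = vs ! l \<longleftrightarrow> k = l" if "k \<le> length es" "l \<le> length es" for k l
    using assms(2) len that by (simp add: nth_eq_iff_index_eq)
  have "(i = j \<and> Suc i = Suc j) \<or> (i = Suc j \<and> Suc i = j)"
    using eq ij(1,2) inj[of i j] inj[of "Suc i" "Suc j"] inj[of i "Suc j"] inj[of "Suc i" j]
    unfolding doubleton_eq_iff by linarith
  with ij(3) show False by linarith
qed

text \<open>
  The first vertex of a longest path is a leaf. A second edge there would lead to a new vertex, making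
  the path longer, or back to the path, closing a cycle.
\<close>

lemma acyclic_has_leaf:
  assumes G: "is_graph G" and acyclic: "\<nexists>vs es. is_cycle G vs es" and "edges G \<noteq> {}"
  obtains e v w where "e \<in> edges G" "v \<in> verts G" "w \<in> verts G" "v \<noteq> w" "ends G e = {v, w}"
    "incident_edges G v = {e}"
proof -
  define path where "path p \<longleftrightarrow> is_walk G (fst p) (snd p) \<and> distinct (fst p) \<and> snd p \<noteq> []" for p
  obtain e0 where e0: "e0 \<in> edges G" using assms by auto
  then obtain x y where xy: "ends G e0 = {x, y}" "x \<noteq> y"
    using acyclic_no_loop[OF G acyclic] by (meson card_2_iff)
  have "path ([x, y], [e0])"
    using e0 xy G by (auto simp: path_def is_walk_def is_graph_def)
  moreover have "\<forall>p. path p \<longrightarrow> length (fst p) < Suc (card (verts G))"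
  proof (intro allI impI)
    fix p assume "path p"
    then have "distinct (fst p)" and "set (fst p) \<subseteq> verts G"
      by (auto simp: path_def is_walk_def)
    then show "length (fst p) < Suc (card (verts G))"
      using G card_mono[of "verts G" "set (fst p)"] by (simp add: is_graph_def distinct_card)
  qed
  ultimately have "\<exists>p. path p \<and> (\<forall>q. path q \<longrightarrow> length (fst q) \<le> length (fst p))"
    by (rule ex_has_greatest_nat)
  then obtain p where p: "path p" "\<And>q. path q \<Longrightarrow> length (fst q) \<le> length (fst p)"
    by blast
  obtain vs es where pe: "p = (vs, es)" by (cases p)
  have walk: "is_walk G vs es" and dist: "distinct vs" and ne: "es \<noteq> []"
    using p(1) pe by (auto simp: path_def)
  have longest: "length vs' \<le> length vs" if "is_walk G vs' es'" "distinct vs'" "es' \<noteq> []" for vs' es'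
    using p(2)[of "(vs', es')"] pe that by (auto simp: path_def)
  define v e where "v = vs ! 0" and "e = es ! 0"
  have len: "length vs = Suc (length es)" using walk by (simp add: is_walk_def)
  have pos: "0 < length es" using ne by simp
  have vsne: "vs \<noteq> []" using len by auto
  then have hd: "hd vs = v" by (simp add: v_def hd_conv_nth)
  have e: "e \<in> edges G" "ends G e = {v, vs ! 1}"
    using walk ne by (auto simp: is_walk_def v_def e_def)
  have V: "v \<in> verts G" "vs ! 1 \<in> verts G"
    using e G by (auto simp: is_graph_def)
  have "v \<noteq> vs ! 1"
    using acyclic_no_loop[OF G acyclic e(1)] e(2) by auto
  moreover have "e' = e" if e': "e' \<in> incident_edges G v" for e'
  proof (rule ccontr)
    assume "e' \<noteq> e"
    have e'E: "e' \<in> edges G" and v: "v \<in> ends G e'" using e' by (auto simp: incident_edges_def)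
    obtain x y where xy: "ends G e' = {x, y}" "x \<noteq> y"
      using acyclic_no_loop[OF G acyclic e'E] by (meson card_2_iff)
    define u where "u = (if x = v then y else x)"
    have u: "ends G e' = {u, v}" "u \<noteq> v"
      using xy v by (auto simp: u_def)
    have uV: "u \<in> verts G" using u e'E G by (auto simp: is_graph_def)
    show False
    proof (cases "u \<in> set vs")
      case False
      have "is_walk G (u # vs) (e' # es)"
        by (rule is_walk_Cons[OF walk vsne e'E _ uV]) (simp add: hd u)
      from longest[OF this] False dist show False by simp
    next
      case True
      then obtain j where j: "j < length vs" "u = vs ! j" by (auto simp: in_set_conv_nth)
      let ?vs = "take (Suc j) vs" and ?es = "take j es"
      have "is_walk G ?vs ?es"
        using walk j len by (auto simp: is_walk_def dest: in_set_takeD)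
      then have walk': "is_walk G (u # ?vs) (e' # ?es)"
        by (rule is_walk_Cons) (simp_all add: vsne hd e'E u uV)
      have last: "last ?vs = u"
        unfolding take_Suc_conv_app_nth[OF j(1)] j(2) by simp
      have new: "e' \<notin> set es"
      proof
        assume "e' \<in> set es"
        then obtain i where i: "i < length es" "e' = es ! i" by (auto simp: in_set_conv_nth)
        have "ends G (es ! i) = {vs ! 0, vs ! j}"
          unfolding i(2)[symmetric] u(1) v_def[symmetric] j(2)[symmetric] by (rule insert_commute)
        then have "i = 0"
          by (rule path_edge_index[OF walk dist i(1) j(1)])
        with i(2) \<open>e' \<noteq> e\<close> show False by (simp add: e_def)
      qed
      have "e' \<notin> set ?es"
        using new in_set_takeD by metis
      moreover have "last (u # ?vs) = u"
        using last vsne by simp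
      ultimately have "is_cycle G (u # ?vs) (e' # ?es)"
        unfolding is_cycle_def using walk' dist distinct_path_edges[OF walk dist]
        by simp
      with acyclic show False by blast
    qed
  qed
  moreover have "e \<in> incident_edges G v" using e by (auto simp: incident_edges_def)
  ultimately have "v \<noteq> vs ! 1" and "incident_edges G v = {e}" by blast+
  with e V show thesis by (intro that)
qed

section \<open>Weighted sums over acyclic graphs\<close>

definition weighted_sum ::
  "('v, 'e) diagram \<Rightarrow> ('e \<Rightarrow> nat \<Rightarrow> int \<Rightarrow> real) \<Rightarrow> ('v \<Rightarrow> nat \<Rightarrow> int \<Rightarrow> real) \<Rightarrow> nat \<Rightarrow> real" where
  "weighted_sum G f h n = (\<Sum>a\<in>edges G \<rightarrow>\<^sub>E int ` {..<n}.
     (\<Prod>e\<in>edges G. f e n (a e)) * (\<Prod>v\<in>verts G. h v n (\<Sum>e\<in>incident_edges G v. a e)))"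

lemma sum_PiE_insert:
  assumes "x \<notin> A"
  shows "(\<Sum>a\<in>insert x A \<rightarrow>\<^sub>E B. F a) = (\<Sum>a\<in>A \<rightarrow>\<^sub>E B. \<Sum>b\<in>B. F (a(x := b)))"
proof -
  have "(\<Sum>a\<in>insert x A \<rightarrow>\<^sub>E B. F a) = (\<Sum>(b, a)\<in>B \<times> (A \<rightarrow>\<^sub>E B). F (a(x := b)))"
    unfolding PiE_insert_eq
    by (subst sum.reindex[OF inj_combinator[OF assms]]) (simp add: case_prod_unfold)
  also have "\<dots> = (\<Sum>b\<in>B. \<Sum>a\<in>A \<rightarrow>\<^sub>E B. F (a(x := b)))"
    by (simp add: sum.cartesian_product)
  finally show ?thesis by (subst (asm) sum.swap)
qed

text \<open>
  Once the product \<open>f e \<cdot> h v\<close> has been absorbed into the weight of \<open>w\<close>, the vertex \<open>v\<close> is isolated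
  and gets the neutral weight \<open>1\<close>.
\<close>

lemma weighted_sum_leaf:
  assumes G: "is_graph G" and e: "e \<in> edges G" "ends G e = {v, w}" "incident_edges G v = {e}"
    and vw: "v \<in> verts G" "w \<in> verts G" "v \<noteq> w"
  shows "weighted_sum G f h n = weighted_sum (delete_edge G e) f
    (h(v := \<lambda>_ _. 1, w := correlation (\<lambda>n a. f e n a * h v n a) (h w))) n"
proof -
  \<comment> \<open>Fix the other variables and sum over the value \<open>b\<close> of \<open>e\<close>: every factor except the three that
    see \<open>b\<close> moves out of the inner sum.\<close>
  let ?E = "edges G - {e}" and ?W = "verts G - {v, w}" and ?I = "int ` {..<n}"
  let ?h = "h(v := \<lambda>_ _. 1, w := correlation (\<lambda>n a. f e n a * h v n a) (h w))"
  have fin: "finite (edges G)" "finite (verts G)" using G by (auto simp: is_graph_def)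
  have finI: "finite (incident_edges G u)" for u
    using fin by (auto simp: incident_edges_def)
  have V: "verts G = insert v (insert w ?W)" using vw by auto
  have prodV: "(\<Prod>u\<in>verts G. p u) = p v * (p w * (\<Prod>u\<in>?W. p u))" for p :: "'a \<Rightarrow> real"
    using fin vw by (subst V) simp
  have prodE: "(\<Prod>d\<in>edges G. p d) = p e * (\<Prod>d\<in>?E. p d)" for p :: "'b \<Rightarrow> real"
    using fin e by (simp add: prod.remove)
  have rest: "(\<Sum>d\<in>incident_edges G u - {e}. (a(e := b)) d) = (\<Sum>d\<in>incident_edges G u - {e}. a d)"
    for a :: "'b \<Rightarrow> int" and b u
    by (intro sum.cong) auto
  have at_w: "(\<Sum>d\<in>incident_edges G w. (a(e := b)) d) = (\<Sum>d\<in>incident_edges G w - {e}. a d) + b"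
    for a :: "'b \<Rightarrow> int" and b
  proof -
    have "e \<in> incident_edges G w" using e by (auto simp: incident_edges_def)
    then show ?thesis by (subst sum.remove[OF finI]) (auto simp: rest)
  qed
  have other: "incident_edges G u - {e} = incident_edges G u" if "u \<in> ?W" for u
    using that e by (auto simp: incident_edges_def)
  have other_sum: "(\<Sum>d\<in>incident_edges G u. (a(e := b)) d) = (\<Sum>d\<in>incident_edges G u. a d)"
    if "u \<in> ?W" for a :: "'b \<Rightarrow> int" and b u
    using rest[of a b u] other[OF that] by simp
  have step: "(\<Sum>b\<in>?I. (\<Prod>d\<in>edges G. f d n ((a(e := b)) d)) *
        (\<Prod>u\<in>verts G. h u n (\<Sum>d\<in>incident_edges G u. (a(e := b)) d))) =
      (\<Prod>d\<in>?E. f d n (a d)) * (\<Prod>u\<in>verts G. ?h u n (\<Sum>d\<in>incident_edges G u - {e}. a d))" for a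
  proof -
    let ?P = "\<Prod>d\<in>?E. f d n (a d)" and ?Q = "\<Prod>u\<in>?W. h u n (\<Sum>d\<in>incident_edges G u. a d)"
    let ?s = "\<Sum>d\<in>incident_edges G w - {e}. a d"
    have "(\<Prod>d\<in>edges G. f d n ((a(e := b)) d)) *
        (\<Prod>u\<in>verts G. h u n (\<Sum>d\<in>incident_edges G u. (a(e := b)) d)) =
        (?P * ?Q) * (f e n b * h v n b * h w n (?s + b))" for b
    proof -
      have "(\<Prod>d\<in>?E. f d n ((a(e := b)) d)) = ?P" by (intro prod.cong) auto
      moreover have "(\<Prod>u\<in>?W. h u n (\<Sum>d\<in>incident_edges G u. (a(e := b)) d)) = ?Q"
        by (intro prod.cong refl) (simp only: other_sum)
      ultimately show ?thesis
        unfolding prodV prodE at_w by (simp add: e(3))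
    qed
    then have "(\<Sum>b\<in>?I. (\<Prod>d\<in>edges G. f d n ((a(e := b)) d)) *
        (\<Prod>u\<in>verts G. h u n (\<Sum>d\<in>incident_edges G u. (a(e := b)) d))) =
        (?P * ?Q) * (\<Sum>b\<in>?I. f e n b * h v n b * h w n (?s + b))"
      by (simp only: sum_distrib_left)
    also have "(\<Sum>b\<in>?I. f e n b * h v n b * h w n (?s + b)) = ?h w n ?s"
      by (simp add: correlation_def sum.reindex)
    also have "?Q = (\<Prod>u\<in>?W. ?h u n (\<Sum>d\<in>incident_edges G u - {e}. a d))"
      by (intro prod.cong refl) (auto simp: other)
    finally show ?thesis
      unfolding prodV using vw by simp
  qed
  have E: "edges G = insert e ?E" using e by auto
  have "weighted_sum G f h n = (\<Sum>a\<in>?E \<rightarrow>\<^sub>E ?I. \<Sum>b\<in>?I. (\<Prod>d\<in>edges G. f d n ((a(e := b)) d)) *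
        (\<Prod>u\<in>verts G. h u n (\<Sum>d\<in>incident_edges G u. (a(e := b)) d)))"
    unfolding weighted_sum_def by (subst (1) E, subst sum_PiE_insert) simp_all
  then show ?thesis
    unfolding step by (simp only: weighted_sum_def delete_edge_simps)
qed

lemma laurent_fun_weighted_sum:
  assumes "is_graph G" and "\<And>vs es. \<not> is_cycle G vs es"
    and "\<And>e. residue_poly (f e)" and "\<And>v. residue_poly (h v)"
  shows "laurent_fun (weighted_sum G f h)"
  using assms
proof (induction "card (edges G)" arbitrary: G h rule: less_induct)
  case less
  show ?case
  proof (cases "edges G = {}")
    case True
    then have "weighted_sum G f h = (\<lambda>n. \<Prod>v\<in>verts G. h v n 0)"
      by (simp add: weighted_sum_def incident_edges_def fun_eq_iff)
    then show ?thesis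
      using less.prems(4) by (simp add: laurent_fun_prod residue_poly_value_zero)
  next
    case False
    obtain e v w where e: "e \<in> edges G" "v \<in> verts G" "w \<in> verts G" "v \<noteq> w" "ends G e = {v, w}"
        "incident_edges G v = {e}"
      using acyclic_has_leaf[OF less.prems(1) _ False] less.prems(2) by metis
    let ?h = "h(v := \<lambda>_ _. 1, w := correlation (\<lambda>n a. f e n a * h v n a) (h w))"
    have "finite (edges G)" using less.prems(1) by (simp add: is_graph_def)
    then have "card (edges (delete_edge G e)) < card (edges G)"
      using e(1) by (simp add: card_Diff1_less del: card_Diff_insert)
    moreover have "\<not> is_cycle (delete_edge G e) vs es" for vs es
      using is_cycle_delete_edge[of G e vs es] less.prems(2)[of vs es] by auto
    moreover have "residue_poly (?h u)" for u
      using less.prems(3,4)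
      by (auto intro: residue_poly_const residue_poly_correlation residue_poly_mult)
    ultimately have "laurent_fun (weighted_sum (delete_edge G e) f ?h)"
      using less.hyps[of "delete_edge G e" ?h] is_graph_delete_edge[OF less.prems(1)] less.prems(3)
      by blast
    then show ?thesis
      by (rule laurent_fun_cong)
        (use weighted_sum_leaf[OF less.prems(1) e(1,5,6,2,3,4)] in simp)
  qed
qed

section \<open>The sums of Bernoulli polynomials\<close>

lemma S_eq_weighted_sum:
  assumes "is_graph G"
  shows "S n G = weighted_sum G
    (\<lambda>e n a. \<Prod>m\<in>#decoration G e. bernoulli_poly m (of_int (a mod int n) / real n))
    (\<lambda>v. if valence G v \<ge> 2 then delta else (\<lambda>_ _. 1)) n"
proof -
  let ?A = "edges G \<rightarrow>\<^sub>E int ` {..<n}"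
  let ?c = "\<lambda>a. \<forall>v\<in>verts G. valence G v \<ge> 2 \<longrightarrow> int n dvd (\<Sum>e\<in>incident_edges G v. a e)"
  let ?b = "\<lambda>a. \<Prod>e\<in>edges G. \<Prod>m\<in>#decoration G e. bernoulli_poly m (of_int (a e) / real n)"
  have fin: "finite (edges G)" "finite (verts G)" using assms by (auto simp: is_graph_def)
  have "{0..int n - 1} = int ` {..<n}"
    by (auto simp: image_iff) (metis zero_le_imp_eq_int zle_diff1_eq of_nat_less_iff lessThan_iff)
  then have "admissible_families n G = {a \<in> ?A. ?c a}"
    by (simp add: admissible_families_def cong_0_iff)
  then have "S n G = (\<Sum>a\<in>?A. if ?c a then ?b a else 0)"
    using fin by (simp add: S_def sum.inter_filter finite_PiE)
  also have "\<dots> = (\<Sum>a\<in>?A. (\<Prod>e\<in>edges G. \<Prod>m\<in>#decoration G e.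
        bernoulli_poly m (of_int (a e mod int n) / real n)) *
      (\<Prod>v\<in>verts G. (if valence G v \<ge> 2 then delta else (\<lambda>_ _. 1)) n (\<Sum>e\<in>incident_edges G v. a e)))"
  proof (intro sum.cong refl)
    fix a assume a: "a \<in> ?A"
    have "a e mod int n = a e" if "e \<in> edges G" for e
      using PiE_mem[OF a that] by auto
    then have "(\<Prod>e\<in>edges G. \<Prod>m\<in>#decoration G e.
        bernoulli_poly m (of_int (a e mod int n) / real n)) = ?b a"
      by (intro prod.cong refl) simp
    moreover have "(\<Prod>v\<in>verts G. (if valence G v \<ge> 2 then delta else (\<lambda>_ _. 1)) n
        (\<Sum>e\<in>incident_edges G v. a e)) = (if ?c a then 1 else 0)"
      using fin by (auto simp: delta_def prod_zero_iff intro!: prod.neutral)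
    ultimately show "(if ?c a then ?b a else 0) = (\<Prod>e\<in>edges G. \<Prod>m\<in>#decoration G e.
        bernoulli_poly m (of_int (a e mod int n) / real n)) *
      (\<Prod>v\<in>verts G. (if valence G v \<ge> 2 then delta else (\<lambda>_ _. 1)) n (\<Sum>e\<in>incident_edges G v. a e))"
      by (auto simp only: mult_1_right mult_zero_right split: if_split)
  qed
  finally show ?thesis by (simp add: weighted_sum_def)
qed

theorem theorem6p6:
  fixes G :: "('v, 'e) diagram"
  assumes "decorated_Feynman_diagram G"
    and "is_tree G"
  shows "\<exists>P :: int \<Rightarrow>\<^sub>0 real. \<forall>n\<ge>1. S n G = eval_laurent P (real n)"
proof -
  have G: "is_graph G" and acyclic: "\<And>vs es. \<not> is_cycle G vs es"
    using assms by (auto simp: is_tree_def)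
  have "laurent_fun (\<lambda>n. S n G)"
    unfolding S_eq_weighted_sum[OF G]
    by (rule laurent_fun_weighted_sum[OF G acyclic residue_poly_decoration])
      (simp add: residue_poly_delta residue_poly_const)
  then show ?thesis by (simp add: laurent_fun_def)
qed

end
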